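(* Let $\boldsymbol S=\boldsymbol D+\boldsymbol D^T$ be positive definite with $s_{ij}\le 0$ for all $i\ne j$, with largest eigenvalue $\lambda_1$, let $\delta_i>0$ for all $i$, and let $L>\lambda_1$. Let $\{\boldsymbol p^t\}_{t=1,2,\dots}$ be a sequence generated by the gradient projection algorithm, i.e. $\boldsymbol p^1\in\mathbb R^n$ satisfies $\|\boldsymbol p^1-\boldsymbol p^0\|_0\le k$ and $$\boldsymbol p^{t+1}\in\mathcal H_{k,\boldsymbol p^0,\boldsymbol\delta}\Big(\boldsymbol p^t-\tfrac1L\nabla\mathcal Q(\boldsymbol p^t)\Big)\quad\text{for all }t\ge1.$$ Then the sequence $\{\boldsymbol p^t\}$ converges to a first-order stationary point: the limit $\lim_{t\to\infty}\boldsymbol p^t=\boldsymbol p^\infty$ exists and satisfies $$\boldsymbol p^\infty\in\mathcal H_{k,\boldsymbol p^0,\boldsymbol\delta}\Big(\boldsymbol p^\infty-\tfrac1L\nabla\mathcal Q(\boldsymbol p^\infty)\Big).$$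
   Context: Let $n\ge1$ and $k\ge 0$ be integers, $\boldsymbol a,\boldsymbol c,\boldsymbol p^0,\boldsymbol\delta\in\mathbb R^n$, $\boldsymbol D\in\mathbb R^{n\times n}$, and $\boldsymbol S=\boldsymbol D+\boldsymbol D^T=(s_{ij})$. Define $\mathcal Q(\boldsymbol p)=\frac12\boldsymbol p^T\boldsymbol S\boldsymbol p-(\boldsymbol a+\boldsymbol D^T\boldsymbol c)^T\boldsymbol p$. For each $i$, $\mathcal P^i_{\delta_i}=\{p_i^0\}\cup[p_i^0+\delta_i,\infty)\cup(-\infty,p_i^0-\delta_i]$, and $\mathcal P_{\boldsymbol\delta}=\mathcal P^1_{\delta_1}\times\cdots\times\mathcal P^n_{\delta_n}$. The feasible set is $\Omega_{k,\boldsymbol p^0,\boldsymbol\delta}=\{\boldsymbol p\in\mathbb R^n\mid\|\boldsymbol p-\boldsymbol p^0\|_0\le k,\ \boldsymbol p\in\mathcal P_{\boldsymbol\delta}\}$, where $\|\cdot\|_0$ counts nonzero entries. $\mathcal H_{k,\boldsymbol p^0,\boldsymbol\delta}(\boldsymbol q)=\arg\min_{\boldsymbol p\in\Omega_{k,\boldsymbol p^0,\boldsymbol\delta}}\|\boldsymbol p-\boldsymbol q\|_2^2$ is the set of all Euclidean projections of $\boldsymbol q$ onto the feasible set (each iterate may be any element of this set). The sequence is considered as an infinite sequence, without a stopping rule. *)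

theory Defs
  imports "HOL-Analysis.Analysis"
begin

definition gradient :: "('a::real_inner \<Rightarrow> real) \<Rightarrow> 'a \<Rightarrow> 'a"
  where "gradient f x = (THE g. GDERIV f x :> g)"

definition eigenvalue :: "real ^ 'n ^ 'n \<Rightarrow> real \<Rightarrow> bool"
  where "eigenvalue A \<mu> \<longleftrightarrow> (\<exists>v. v \<noteq> 0 \<and> A *v v = \<mu> *\<^sub>R v)"

definition positive_definite :: "real ^ 'n ^ 'n \<Rightarrow> bool"
  where "positive_definite A \<longleftrightarrow> transpose A = A \<and> (\<forall>x. x \<noteq> 0 \<longrightarrow> x \<bullet> (A *v x) > 0)"

definition l0_norm :: "real ^ 'n \<Rightarrow> nat"
  where "l0_norm x = card {i. x $ i \<noteq> 0}"

definition quad_obj :: "real ^ 'n ^ 'n \<Rightarrow> real ^ 'n \<Rightarrow> real ^ 'n \<Rightarrow> real ^ 'n \<Rightarrow> real"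
  where "quad_obj D a c p =
    1/2 * (p \<bullet> ((D + transpose D) *v p)) - (a + transpose D *v c) \<bullet> p"

definition price_range :: "real \<Rightarrow> real \<Rightarrow> real set"
  where "price_range r d = {r} \<union> {r + d..} \<union> {..r - d}"

definition feasible :: "nat \<Rightarrow> real ^ 'n \<Rightarrow> real ^ 'n \<Rightarrow> (real ^ 'n) set"
  where "feasible k p0 \<delta> =
    {p. l0_norm (p - p0) \<le> k \<and> (\<forall>i. p $ i \<in> price_range (p0 $ i) (\<delta> $ i))}"

text \<open>The feasible set is not convex, so the projection is the set of all minimisers
  rather than a single point.\<close>

definition proj_feasible :: "nat \<Rightarrow> real ^ 'n \<Rightarrow> real ^ 'n \<Rightarrow> real ^ 'n \<Rightarrow> (real ^ 'n) set"
  where "proj_feasible k p0 \<delta> q =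
    {p. is_arg_min (\<lambda>p. (norm (p - q))\<^sup>2) (\<lambda>p. p \<in> feasible k p0 \<delta>) p}"

end

theory Submission
  imports Defs
begin

text \<open>Sufficient decrease of the objective (from \<open>L > lam1\<close>) makes the step lengths tend to
  zero. A feasible price that differs from \<open>p0\<close> in a coordinate \<open>i\<close> does so by at least \<open>\<delta>\<^sub>i\<close>, so
  once the steps are shorter than every \<open>\<delta>\<^sub>i\<close>, two successive iterates lie in a common closed convex
  piece of the feasible set. On such a piece the projection is nonexpansive, and the gradient
  step is a contraction since \<open>S\<close> is positive definite; hence the steps decay geometrically.\<close>

section \<open>Symmetric matrices\<close>

lemma inner_matrix_sym:
  fixes A :: "real ^ 'n ^ 'n"
  assumes "transpose A = A"
  shows "x \<bullet> (A *v y) = (A *v x) \<bullet> y"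
  by (metis assms dot_lmul_matrix transpose_matrix_vector)

text \<open>The form is nonnegative on all combinations of \<open>x\<close> and \<open>y\<close>, so
  its discriminant there cannot be positive. Semidefinite \<open>A\<close> is allowed because the
  later use is for a singular matrix.\<close>

lemma psd_Cauchy_Schwarz:
  fixes A :: "real ^ 'n ^ 'n"
  assumes sym: "transpose A = A" and psd: "\<And>x. 0 \<le> x \<bullet> (A *v x)"
  shows "(x \<bullet> (A *v y))\<^sup>2 \<le> (x \<bullet> (A *v x)) * (y \<bullet> (A *v y))"
proof -
  let ?\<alpha> = "x \<bullet> (A *v x)" and ?\<beta> = "y \<bullet> (A *v y)" and ?\<gamma> = "x \<bullet> (A *v y)"
  have comm: "y \<bullet> (A *v x) = ?\<gamma>"
    using inner_matrix_sym[OF sym] by (metis inner_commute)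
  have expand: "0 \<le> r\<^sup>2 * ?\<alpha> + 2 * r * s * ?\<gamma> + s\<^sup>2 * ?\<beta>" for r s
    using psd[of "r *\<^sub>R x + s *\<^sub>R y"] comm
    by (simp add: matrix_vector_right_distrib scaleR_matrix_vector_assoc[symmetric]
        matrix_vector_mult_scaleR inner_add_left inner_add_right power2_eq_square algebra_simps)
  show ?thesis
  proof (cases "?\<beta> = 0")
    case True
    have "?\<gamma> = 0"
    proof (rule ccontr)
      assume "?\<gamma> \<noteq> 0"
      \<comment> \<open>This coefficient makes the form in \<open>expand\<close> equal to
        -1.\<close>
      then show False
        using expand[of 1 "- (?\<alpha> + 1) / (2 * ?\<gamma>)"] psd[of x] True by (simp add: field_simps)
    qed
    with True show ?thesis by simp
  next
    case False
    then have "?\<beta> > 0" using psd[of y] by simp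
    \<comment> \<open>The choice r = \<open>?\<beta>\<close>, s = \<open>- ?\<gamma>\<close>
      minimises the form over s for this r and leaves a multiple of \<open>?\<beta>\<close>.\<close>
    moreover have "0 \<le> ?\<beta> * (?\<alpha> * ?\<beta> - ?\<gamma>\<^sup>2)"
      using expand[of ?\<beta> "- ?\<gamma>"] by (simp add: power2_eq_square algebra_simps)
    ultimately show ?thesis by (simp add: zero_le_mult_iff)
  qed
qed

text \<open>A maximiser \<open>v\<close> of the form on the unit sphere is an eigenvector: the
  matrix \<open>mat \<mu> - A\<close> is positive semidefinite and its form vanishes at
  \<open>v\<close>, which by Cauchy-Schwarz forces \<open>v\<close> into its kernel.\<close>

lemma Rayleigh_max_eigenvalue:
  fixes A :: "real ^ 'n ^ 'n"
  assumes sym: "transpose A = A"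
  obtains \<mu> where "eigenvalue A \<mu>" "\<And>x. x \<bullet> (A *v x) \<le> \<mu> * (norm x)\<^sup>2"
proof -
  let ?q = "\<lambda>x. x \<bullet> (A *v x)"
  have "continuous_on (sphere 0 1) ?q"
    by (intro continuous_intros matrix_vector_mult_linear_continuous_on)
  moreover have "compact (sphere (0 :: real ^ 'n) 1)" "sphere (0 :: real ^ 'n) 1 \<noteq> {}"
    by auto
  ultimately obtain v where v: "norm v = 1" and max: "\<And>x. norm x = 1 \<Longrightarrow> ?q x \<le> ?q v"
    using continuous_attains_sup[of "sphere (0 :: real ^ 'n) 1" ?q] by auto
  define \<mu> where "\<mu> = ?q v"
  have bound: "?q x \<le> \<mu> * (norm x)\<^sup>2" for x
  proof (cases "x = 0")
    case False
    have "?q ((1 / norm x) *\<^sub>R x) \<le> \<mu>"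
      unfolding \<mu>_def using False by (intro max) simp
    then show ?thesis
      using False by (simp add: matrix_vector_mult_scaleR power2_eq_square field_simps)
  qed simp
  define B where "B = mat \<mu> - A"
  have "mat \<mu> *v x = \<mu> *\<^sub>R x" for x :: "real ^ 'n"
    by (simp add: vec_eq_iff matrix_vector_mult_def mat_def if_distrib if_distribR cong: if_cong)
  then have Bv: "B *v x = \<mu> *\<^sub>R x - A *v x" for x
    by (simp add: B_def matrix_vector_mult_diff_rdistrib)
  have "transpose B = B"
    using sym by (simp add: B_def transpose_def mat_def vec_eq_iff)
  moreover have "0 \<le> x \<bullet> (B *v x)" for x
    using bound[of x] by (simp add: Bv inner_diff_right power2_norm_eq_inner)
  \<comment> \<open>With \<open>B *v v\<close> as the first argument, the left side is the fourth
    power of its norm, while the last factor on the right is zero.\<close>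
  ultimately have "((B *v v) \<bullet> (B *v v))\<^sup>2 \<le> ((B *v v) \<bullet> (B *v (B *v v))) * (v \<bullet> (B *v v))"
    by (rule psd_Cauchy_Schwarz)
  also have "v \<bullet> (B *v v) = 0"
    using v by (simp add: Bv inner_diff_right \<mu>_def norm_eq_1)
  finally have "A *v v = \<mu> *\<^sub>R v" by (simp add: Bv)
  then have "eigenvalue A \<mu>" using v unfolding eigenvalue_def by (metis norm_zero zero_neq_one)
  with bound that show ?thesis by blast
qed

text \<open>The Rayleigh bound for \<open>- A\<close> has a constant \<open>\<mu>\<close> that is an
  eigenvalue of \<open>- A\<close>; so \<open>- \<mu>\<close> is an eigenvalue of \<open>A\<close>,
  hence positive, and serves as \<open>m\<close>.\<close>

lemma positive_definite_coercive:
  fixes A :: "real ^ 'n ^ 'n"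
  assumes "positive_definite A"
  obtains m where "m > 0" "\<And>x. m * (norm x)\<^sup>2 \<le> x \<bullet> (A *v x)"
proof -
  have neg: "(- A) *v x = - (A *v x)" for x
    using matrix_vector_mult_diff_rdistrib[of 0 A x] by simp
  have "transpose (- A) = - A"
    using assms by (simp add: positive_definite_def transpose_def vec_eq_iff)
  then obtain \<mu> where \<mu>: "eigenvalue (- A) \<mu>" "\<And>x. x \<bullet> (- A *v x) \<le> \<mu> * (norm x)\<^sup>2"
    by (rule Rayleigh_max_eigenvalue) blast
  from \<mu>(1) obtain v where v: "v \<noteq> 0" "A *v v = (- \<mu>) *\<^sub>R v"
    unfolding eigenvalue_def neg by (metis neg_equal_iff_equal scaleR_minus_left minus_minus)
  then have "- \<mu> * (v \<bullet> v) > 0"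
    using assms by (metis inner_scaleR_right positive_definite_def)
  then have "- \<mu> > 0" by (rule zero_less_mult_pos2) (use v(1) in simp)
  moreover have "- \<mu> * (norm x)\<^sup>2 \<le> x \<bullet> (A *v x)" for x
    using \<mu>(2)[of x] by (simp add: neg)
  ultimately show ?thesis using that by blast
qed

text \<open>Cauchy-Schwarz for the form of \<open>A\<close>, applied to \<open>A *v x\<close> and
  \<open>x\<close>, followed by division by the squared norm of \<open>A *v x\<close>. This is the
  cocoercivity of the linear map \<open>A\<close>.\<close>

lemma norm_matrix_sq_le:
  fixes A :: "real ^ 'n ^ 'n"
  assumes sym: "transpose A = A" and psd: "\<And>x. 0 \<le> x \<bullet> (A *v x)"
    and ub: "\<And>x. x \<bullet> (A *v x) \<le> \<Lambda> * (norm x)\<^sup>2"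
  shows "(norm (A *v x))\<^sup>2 \<le> \<Lambda> * (x \<bullet> (A *v x))"
proof (cases "A *v x = 0")
  case False
  let ?y = "A *v x"
  have "(?y \<bullet> (A *v x))\<^sup>2 \<le> (?y \<bullet> (A *v ?y)) * (x \<bullet> (A *v x))"
    using sym psd by (rule psd_Cauchy_Schwarz)
  also have "\<dots> \<le> (\<Lambda> * (norm ?y)\<^sup>2) * (x \<bullet> (A *v x))"
    using ub psd by (intro mult_right_mono)
  finally have "(norm ?y)\<^sup>2 * (norm ?y)\<^sup>2 \<le> (norm ?y)\<^sup>2 * (\<Lambda> * (x \<bullet> (A *v x)))"
    by (simp only: power2_norm_eq_inner[symmetric] power2_eq_square mult_ac)
  then show ?thesis by (rule mult_left_le_imp_le) (use False in simp)
qed simp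

text \<open>In the expanded square, cocoercivity and \<open>\<Lambda> < L\<close> bound the
  quadratic term by \<open>?e / L\<close>, half of the negative cross term
  \<open>2 / L * ?e\<close>. Coercivity turns the surviving \<open>- ?e / L\<close> into a fixed
  proportion of the squared norm.\<close>

lemma gradient_step_contraction:
  fixes A :: "real ^ 'n ^ 'n"
  assumes sym: "transpose A = A" and "m > 0" "\<Lambda> < L"
    and lb: "\<And>x. m * (norm x)\<^sup>2 \<le> x \<bullet> (A *v x)"
    and ub: "\<And>x. x \<bullet> (A *v x) \<le> \<Lambda> * (norm x)\<^sup>2"
    and "L > 0"
  shows "norm (x - (1 / L) *\<^sub>R (A *v x)) \<le> sqrt (1 - m / L) * norm x"
proof -
  have psd: "0 \<le> x \<bullet> (A *v x)" for x
    using lb[of x] \<open>m > 0\<close> by (meson less_imp_le mult_nonneg_nonneg order_trans zero_le_power2)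
  let ?e = "x \<bullet> (A *v x)"
  have "(norm (x - (1 / L) *\<^sub>R (A *v x)))\<^sup>2 = (norm x)\<^sup>2 - 2 / L * ?e + (norm (A *v x))\<^sup>2 / L\<^sup>2"
    unfolding power2_norm_eq_inner
    by (simp add: inner_diff_left inner_diff_right inner_commute power2_eq_square)
  also have "\<dots> \<le> (norm x)\<^sup>2 - 2 / L * ?e + L * ?e / L\<^sup>2"
    using norm_matrix_sq_le[OF sym psd ub, of x] mult_right_mono[OF less_imp_le[OF \<open>\<Lambda> < L\<close>] psd[of x]]
    by (intro add_left_mono divide_right_mono) auto
  also have "\<dots> = (norm x)\<^sup>2 - ?e / L"
    using \<open>L > 0\<close> by (simp add: power2_eq_square field_simps)
  also have "\<dots> \<le> (norm x)\<^sup>2 - m * (norm x)\<^sup>2 / L"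
    using lb[of x] \<open>L > 0\<close> by (simp add: divide_right_mono)
  also have "\<dots> = (1 - m / L) * (norm x)\<^sup>2"
    by (simp add: algebra_simps)
  \<comment> \<open>The real function \<open>sqrt\<close> is odd, and monotone and multiplicative on
    the whole line, so the sign of \<open>1 - m / L\<close> does not matter.\<close>
  finally have "sqrt ((norm (x - (1 / L) *\<^sub>R (A *v x)))\<^sup>2) \<le> sqrt ((1 - m / L) * (norm x)\<^sup>2)"
    by (rule real_sqrt_le_mono)
  then show ?thesis by (simp add: real_sqrt_mult)
qed

section \<open>The quadratic objective\<close>

lemma quad_obj_add:
  fixes D :: "real ^ 'n ^ 'n"
  assumes S_def: "S = D + transpose D"
  shows "quad_obj D a c (x + h) =
    quad_obj D a c x + h \<bullet> (S *v x - (a + transpose D *v c)) + 1/2 * (h \<bullet> (S *v h))"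
proof -
  have "transpose S = S"
    by (simp add: S_def transpose_def vec_eq_iff)
  then have "x \<bullet> (S *v h) = h \<bullet> (S *v x)"
    by (metis inner_matrix_sym inner_commute)
  then show ?thesis
    unfolding quad_obj_def S_def[symmetric]
    by (simp add: matrix_vector_right_distrib inner_add_left inner_add_right inner_diff_right
        inner_commute algebra_simps)
qed

lemma gradient_quad_obj:
  fixes D :: "real ^ 'n ^ 'n"
  assumes S_def: "S = D + transpose D"
  shows "gradient (quad_obj D a c) x = S *v x - (a + transpose D *v c)"
proof -
  let ?g = "S *v x - (a + transpose D *v c)"
  have sym: "transpose S = S"
    by (simp add: S_def transpose_def vec_eq_iff)
  have comm: "x \<bullet> (S *v h) = h \<bullet> (S *v x)" for h
    by (metis inner_matrix_sym[OF sym] inner_commute)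
  have "(quad_obj D a c has_derivative
      (\<lambda>h. 1/2 * (x \<bullet> (S *v h) + h \<bullet> (S *v x)) - (a + transpose D *v c) \<bullet> h)) (at x)"
    unfolding quad_obj_def[abs_def] S_def[symmetric]
    by (auto intro!: derivative_eq_intros bounded_linear.has_derivative
        [OF matrix_vector_mul_bounded_linear])
  then have d: "GDERIV (quad_obj D a c) x :> ?g"
    unfolding gderiv_def
    by (rule has_derivative_eq_rhs) (auto simp: fun_eq_iff comm inner_diff_right inner_commute)
  \<comment> \<open>Since \<open>gradient\<close> is a definite description, uniqueness has to
    accompany existence.\<close>
  have "g = ?g" if "GDERIV (quad_obj D a c) x :> g" for g
  proof -
    have "(\<lambda>h. h \<bullet> g) = (\<lambda>h. h \<bullet> ?g)"
      using that d unfolding gderiv_def by (rule has_derivative_unique)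
    then show ?thesis by (simp add: fun_eq_iff vector_eq_rdot vector_eq_ldot)
  qed
  with d show ?thesis unfolding gradient_def by (intro the_equality)
qed

lemma quad_obj_bounded_below:
  fixes D :: "real ^ 'n ^ 'n"
  assumes "S = D + transpose D" "m > 0" and lb: "\<And>x. m * (norm x)\<^sup>2 \<le> x \<bullet> (S *v x)"
  shows "- (norm (a + transpose D *v c))\<^sup>2 / (2 * m) \<le> quad_obj D a c x"
proof -
  let ?b = "a + transpose D *v c"
  \<comment> \<open>Completing the square in \<open>norm x\<close>, after the linear term is bounded
    by Cauchy-Schwarz.\<close>
  have "0 \<le> (m * norm x - norm ?b)\<^sup>2 / (2 * m)"
    using \<open>m > 0\<close> by simp
  then have "- (norm ?b)\<^sup>2 / (2 * m) \<le> 1/2 * (m * (norm x)\<^sup>2) - norm ?b * norm x"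
    using \<open>m > 0\<close> by (simp add: power2_eq_square field_simps)
  also have "\<dots> \<le> quad_obj D a c x"
    using lb[of x] norm_cauchy_schwarz[of ?b x]
    unfolding quad_obj_def assms(1)[symmetric] by linarith
  finally show ?thesis .
qed

section \<open>The feasible set\<close>

lemma proj_feasible_iff:
  "x \<in> proj_feasible k p0 \<delta> q \<longleftrightarrow>
    x \<in> feasible k p0 \<delta> \<and> (\<forall>y \<in> feasible k p0 \<delta>. dist q x \<le> dist q y)"
  by (auto simp: proj_feasible_def is_arg_min_def dist_norm norm_minus_commute not_less)

text \<open>The face of the feasible set around \<open>x\<close>: each coordinate stays in the component of the
  price range that contains \<open>x\<^sub>i\<close>.\<close>

definition face :: "real ^ 'n \<Rightarrow> real ^ 'n \<Rightarrow> real ^ 'n \<Rightarrow> (real ^ 'n) set"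
  where "face p0 \<delta> x = {y. \<forall>i. (x $ i = p0 $ i \<longrightarrow> y $ i = p0 $ i) \<and>
    (p0 $ i + \<delta> $ i \<le> x $ i \<longrightarrow> p0 $ i + \<delta> $ i \<le> y $ i) \<and>
    (x $ i \<le> p0 $ i - \<delta> $ i \<longrightarrow> y $ i \<le> p0 $ i - \<delta> $ i)}"

lemma face_refl: "x \<in> face p0 \<delta> x"
  by (simp add: face_def)

lemma closed_face: "closed (face p0 \<delta> x)"
  unfolding face_def
  by (intro closed_Collect_all closed_Collect_conj closed_Collect_imp closed_Collect_eq
      closed_Collect_le open_Collect_const continuous_intros)

lemma convex_face: "convex (face p0 \<delta> x)"
proof (rule convexI)
  fix y z and u v :: real
  assume y: "y \<in> face p0 \<delta> x" and z: "z \<in> face p0 \<delta> x"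
    and uv: "0 \<le> u" "0 \<le> v" "u + v = 1"
  have eq: "u * r + v * r = r" for r
    using uv(3) by (metis distrib_right mult_1)
  have ge: "r \<le> u * s + v * t" if "r \<le> s" "r \<le> t" for r s t
    using add_mono[OF mult_left_mono[OF that(1) uv(1)] mult_left_mono[OF that(2) uv(2)]] eq by simp
  have le: "u * s + v * t \<le> r" if "s \<le> r" "t \<le> r" for r s t
    using add_mono[OF mult_left_mono[OF that(1) uv(1)] mult_left_mono[OF that(2) uv(2)]] eq by simp
  show "u *\<^sub>R y + v *\<^sub>R z \<in> face p0 \<delta> x"
    using y z by (auto simp: face_def eq intro: ge le)
qed

text \<open>A point of the face agrees with \<open>p0\<close> wherever \<open>x\<close> does, so it
  changes no further coordinates.\<close>

lemma face_subset_feasible: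
  assumes "x \<in> feasible k p0 \<delta>"
  shows "face p0 \<delta> x \<subseteq> feasible k p0 \<delta>"
proof
  fix y assume y: "y \<in> face p0 \<delta> x"
  then have "{i. (y - p0) $ i \<noteq> 0} \<subseteq> {i. (x - p0) $ i \<noteq> 0}"
    by (auto simp: face_def)
  then have "l0_norm (y - p0) \<le> l0_norm (x - p0)"
    unfolding l0_norm_def by (intro card_mono) auto
  moreover have "y $ i \<in> price_range (p0 $ i) (\<delta> $ i)" for i
  proof -
    have "x $ i \<in> price_range (p0 $ i) (\<delta> $ i)"
      using assms by (simp add: feasible_def)
    then show ?thesis using y by (auto simp: price_range_def face_def)
  qed
  ultimately show "y \<in> feasible k p0 \<delta>"
    using assms by (simp add: feasible_def)
qed

text \<open>The point and the two rays that make up a price range are at least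
  \<open>\<delta> $ i\<close> apart, so a strictly shorter move cannot change component.\<close>

lemma near_feasible_in_face:
  assumes pos: "\<And>i. \<delta> $ i > 0" and x: "x \<in> feasible k p0 \<delta>" and y: "y \<in> feasible k p0 \<delta>"
    and near: "\<And>i. \<bar>y $ i - x $ i\<bar> < \<delta> $ i"
  shows "y \<in> face p0 \<delta> x"
proof -
  have "(x $ i = p0 $ i \<longrightarrow> y $ i = p0 $ i) \<and>
    (p0 $ i + \<delta> $ i \<le> x $ i \<longrightarrow> p0 $ i + \<delta> $ i \<le> y $ i) \<and>
    (x $ i \<le> p0 $ i - \<delta> $ i \<longrightarrow> y $ i \<le> p0 $ i - \<delta> $ i)" for i
  proof -
    have "y $ i \<in> price_range (p0 $ i) (\<delta> $ i)"
      using y by (simp add: feasible_def)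
    then show ?thesis
      using near[of i] pos[of i] by (auto simp: price_range_def)
  qed
  then show ?thesis by (simp add: face_def)
qed

text \<open>The tail of a convergent feasible sequence stays in a single face, which is closed and
  consists of feasible points.\<close>

lemma closed_feasible:
  assumes pos: "\<And>i. \<delta> $ i > 0"
  shows "closed (feasible k p0 \<delta>)"
proof (unfold closed_sequential_limits, intro allI impI, elim conjE)
  fix f l assume f: "\<forall>n. f n \<in> feasible k p0 \<delta>" and lim: "f \<longlonglongrightarrow> l"
  \<comment> \<open>Half of \<open>\<delta> $ i\<close>, so that any two terms of the tail differ by
    less than \<open>\<delta> $ i\<close>.\<close>
  have "\<forall>\<^sub>F n in sequentially. \<bar>f n $ i - l $ i\<bar> < \<delta> $ i / 2" for i
    using tendstoD[OF tendsto_vec_nth[OF lim, of i], of "\<delta> $ i / 2"] pos[of i]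
    by (simp add: dist_real_def)
  then have "\<forall>\<^sub>F n in sequentially. \<forall>i. \<bar>f n $ i - l $ i\<bar> < \<delta> $ i / 2"
    by (rule eventually_all_finite)
  then obtain N where N: "\<And>n i. n \<ge> N \<Longrightarrow> \<bar>f n $ i - l $ i\<bar> < \<delta> $ i / 2"
    by (auto simp: eventually_sequentially)
  have "f n \<in> face p0 \<delta> (f N)" if "n \<ge> N" for n
  proof (rule near_feasible_in_face)
    show "\<bar>f n $ i - f N $ i\<bar> < \<delta> $ i" for i
      using N[OF that, of i] N[of N i] by (simp add: abs_if split: if_splits)
  qed (use pos f in auto)
  then have "l \<in> face p0 \<delta> (f N)"
    by (intro Lim_in_closed_set[OF closed_face _ _ lim]) (auto simp: eventually_sequentially)
  then show "l \<in> feasible k p0 \<delta>"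
    using face_subset_feasible f by blast
qed

text \<open>Both \<open>x\<close> and \<open>y\<close> lie in the closed convex face of
  \<open>x\<close>, so each, being nearest among all feasible points, is also nearest within that
  face. Adding the two variational inequalities gives the usual nonexpansiveness.\<close>

lemma proj_feasible_nonexpansive:
  assumes x: "x \<in> proj_feasible k p0 \<delta> q" and y: "y \<in> proj_feasible k p0 \<delta> r"
    and face: "y \<in> face p0 \<delta> x"
  shows "norm (y - x) \<le> norm (r - q)"
proof -
  have sub: "face p0 \<delta> x \<subseteq> feasible k p0 \<delta>"
    using x by (intro face_subset_feasible) (simp add: proj_feasible_iff)
  have "(q - x) \<bullet> (y - x) \<le> 0"
    using x sub by (intro any_closest_point_dot[OF convex_face closed_face face_refl face])
      (auto simp: proj_feasible_iff)
  moreover have "(r - y) \<bullet> (x - y) \<le> 0"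
    using y sub by (intro any_closest_point_dot[OF convex_face closed_face face face_refl])
      (auto simp: proj_feasible_iff)
  ultimately have "(y - x) \<bullet> (y - x) \<le> (r - q) \<bullet> (y - x)"
    by (simp add: inner_diff_left inner_diff_right inner_commute)
  then have "norm (y - x) * norm (y - x) \<le> norm (r - q) * norm (y - x)"
    using norm_cauchy_schwarz[of "r - q" "y - x"]
    by (simp add: power2_norm_eq_inner[symmetric] power2_eq_square)
  then show ?thesis
    by (cases "norm (y - x) = 0") auto
qed

text \<open>Feasibility survives the limit by closedness, and each distance comparison by
  continuity. This yields stationarity once convergence is known.\<close>

lemma proj_feasible_closed_graph:
  assumes pos: "\<And>i. \<delta> $ i > 0" and p: "p \<longlonglongrightarrow> x" and q: "q \<longlonglongrightarrow> r"
    and proj: "\<And>n. p n \<in> proj_feasible k p0 \<delta> (q n)"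
  shows "x \<in> proj_feasible k p0 \<delta> r"
  unfolding proj_feasible_iff
proof (intro conjI ballI)
  show "x \<in> feasible k p0 \<delta>"
    using proj by (intro closed_sequentially[OF closed_feasible[OF pos] _ p])
      (simp add: proj_feasible_iff)
  fix y assume "y \<in> feasible k p0 \<delta>"
  then have "dist (q n) (p n) \<le> dist (q n) y" for n
    using proj by (simp add: proj_feasible_iff)
  then show "dist r x \<le> dist r y"
    by (intro tendsto_le[OF _ tendsto_dist[OF q tendsto_const] tendsto_dist[OF q p]]) auto
qed

section \<open>Convergence\<close>

text \<open>The feasible point \<open>x\<close> competes with its successor \<open>y\<close> in the
  projection, which bounds the linear term of the exact expansion of the objective by
  \<open>- L / 2\<close> times the squared step; the quadratic term gives back at most
  \<open>\<Lambda> / 2\<close> times it.\<close>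

lemma proj_gradient_decrease:
  fixes D S :: "real ^ 'n ^ 'n"
  assumes S_def: "S = D + transpose D" and ub: "\<And>x. x \<bullet> (S *v x) \<le> \<Lambda> * (norm x)\<^sup>2"
    and "L > 0" and x: "x \<in> feasible k p0 \<delta>"
    and y: "y \<in> proj_feasible k p0 \<delta> (x - (1 / L) *\<^sub>R gradient (quad_obj D a c) x)"
  shows "quad_obj D a c y \<le> quad_obj D a c x - (L - \<Lambda>) / 2 * (norm (y - x))\<^sup>2"
proof -
  define g where "g = S *v x - (a + transpose D *v c)"
  define h where "h = y - x"
  have "dist (x - (1 / L) *\<^sub>R g) y \<le> dist (x - (1 / L) *\<^sub>R g) x"
    using x y unfolding proj_feasible_iff gradient_quad_obj[OF S_def] g_def by blast
  then have "(norm (h + (1 / L) *\<^sub>R g))\<^sup>2 \<le> (norm ((1 / L) *\<^sub>R g))\<^sup>2"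
    by (intro power_mono) (auto simp: dist_norm h_def norm_minus_commute algebra_simps)
  then have "h \<bullet> h + 2 / L * (h \<bullet> g) \<le> 0"
    unfolding power2_norm_eq_inner
    by (simp add: inner_add_left inner_add_right inner_commute)
  then have "2 * (h \<bullet> g) \<le> - (L * (norm h)\<^sup>2)"
    using \<open>L > 0\<close> by (simp add: power2_norm_eq_inner field_simps)
  moreover have "quad_obj D a c y = quad_obj D a c x + h \<bullet> g + 1/2 * (h \<bullet> (S *v h))"
    using quad_obj_add[OF S_def, of a c x h] unfolding g_def h_def by simp
  ultimately have "quad_obj D a c y \<le> quad_obj D a c x - (L * (norm h)\<^sup>2 - \<Lambda> * (norm h)\<^sup>2) / 2"
    using ub[of h] by argo
  then show ?thesis
    by (simp add: h_def left_diff_distrib)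
qed

text \<open>The values of \<open>f\<close> decrease and are bounded below, so their successive
  differences, which dominate the squared steps, tend to zero.\<close>

lemma steps_tendsto_0:
  fixes p :: "nat \<Rightarrow> 'a::real_normed_vector"
  assumes "\<epsilon> > 0" and bdd: "\<And>n. B \<le> f (p n)"
    and dec: "\<And>n. f (p (Suc n)) \<le> f (p n) - \<epsilon> * (norm (p (Suc n) - p n))\<^sup>2"
  shows "(\<lambda>n. p (Suc n) - p n) \<longlonglongrightarrow> 0"
proof -
  have "f (p (Suc n)) \<le> f (p n)" for n
    using dec[of n]
      mult_nonneg_nonneg[OF less_imp_le[OF \<open>\<epsilon> > 0\<close>] zero_le_power2[of "norm (p (Suc n) - p n)"]]
    by linarith
  then have "decseq (\<lambda>n. f (p n))" by (rule decseq_SucI)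
  then obtain l where l: "(\<lambda>n. f (p n)) \<longlonglongrightarrow> l"
    using bdd decseq_convergent[of "\<lambda>n. f (p n)" B] by blast
  have "(\<lambda>n. (f (p n) - f (p (Suc n))) / \<epsilon>) \<longlonglongrightarrow> (l - l) / \<epsilon>"
    using \<open>\<epsilon> > 0\<close> by (intro tendsto_intros l LIMSEQ_Suc[OF l]) auto
  moreover have "(norm (p (Suc n) - p n))\<^sup>2 \<le> (f (p n) - f (p (Suc n))) / \<epsilon>" for n
    using dec[of n] \<open>\<epsilon> > 0\<close> by (simp add: field_simps)
  ultimately have "(\<lambda>n. (norm (p (Suc n) - p n))\<^sup>2) \<longlonglongrightarrow> 0"
    by - (rule Lim_null_comparison[OF always_eventually], simp_all)
  from tendsto_real_sqrt[OF this] show ?thesis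
    by (simp add: tendsto_norm_zero_iff)
qed

text \<open>By the ratio test the steps are summable, and their partial sums telescope to the
  sequence.\<close>

lemma convergent_geometric_steps:
  fixes p :: "nat \<Rightarrow> 'a::banach"
  assumes "\<rho> < 1" and "\<And>n. n \<ge> N \<Longrightarrow> norm (p (Suc (Suc n)) - p (Suc n)) \<le> \<rho> * norm (p (Suc n) - p n)"
  shows "convergent p"
proof -
  have "summable (\<lambda>n. p (Suc n) - p n)"
    using assms by (rule summable_ratio_test)
  then have "convergent (\<lambda>n. (\<Sum>i<n. p (Suc i) - p i) + p 0)"
    by (intro convergent_add convergent_const) (simp add: summable_iff_convergent)
  then show ?thesis by (simp add: sum_lessThan_telescope)
qed

theorem theorem22:
  fixes D S :: "real ^ 'n ^ 'n"
    and a c p0 \<delta> :: "real ^ 'n"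
    and k :: nat
    and L lam1 :: real
    and p :: "nat \<Rightarrow> real ^ 'n"
  assumes S_def: "S = D + transpose D"
    and "positive_definite S"
    and "\<And>i j. i \<noteq> j \<Longrightarrow> S $ i $ j \<le> 0"
    and "eigenvalue S lam1"
    and "\<And>\<mu>. eigenvalue S \<mu> \<Longrightarrow> \<mu> \<le> lam1"
    and "\<And>i. \<delta> $ i > 0"
    and "L > lam1"
    and "l0_norm (p 1 - p0) \<le> k"
    and "\<And>t. t \<ge> 1 \<Longrightarrow>
      p (t + 1) \<in> proj_feasible k p0 \<delta> (p t - (1 / L) *\<^sub>R gradient (quad_obj D a c) (p t))"
  shows "\<exists>p_inf. p \<longlonglongrightarrow> p_inf \<and>
    p_inf \<in> proj_feasible k p0 \<delta> (p_inf - (1 / L) *\<^sub>R gradient (quad_obj D a c) p_inf)"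
proof -
  let ?Q = "quad_obj D a c"
  define T where "T x = x - (1 / L) *\<^sub>R gradient ?Q x" for x
  have T: "T x = x - (1 / L) *\<^sub>R (S *v x - (a + transpose D *v c))" for x
    by (simp add: T_def gradient_quad_obj[OF S_def])
  have sym: "transpose S = S"
    using assms(2) by (simp add: positive_definite_def)
  obtain \<mu> where \<mu>: "eigenvalue S \<mu>" "\<And>x. x \<bullet> (S *v x) \<le> \<mu> * (norm x)\<^sup>2"
    using Rayleigh_max_eigenvalue[OF sym] by blast
  have ub: "x \<bullet> (S *v x) \<le> lam1 * (norm x)\<^sup>2" for x
    using \<mu>(2)[of x] mult_right_mono[OF assms(5)[OF \<mu>(1)], of "(norm x)\<^sup>2"] by simp
  obtain m where m: "m > 0" "\<And>x. m * (norm x)\<^sup>2 \<le> x \<bullet> (S *v x)"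
    using positive_definite_coercive[OF assms(2)] by blast
  \<comment> \<open>Both bounds are compared at one unit vector; \<open>undefined\<close> is just
    some index.\<close>
  have "m \<le> lam1"
    using m(2)[of "axis undefined 1"] ub[of "axis undefined 1"] by (simp add: norm_axis_1)
  then have "L > 0" using m(1) \<open>L > lam1\<close> by simp

  text \<open>The shift by two skips \<open>p 1\<close>, which need not lie in the feasible set.\<close>
  define q where "q n = p (n + 2)" for n
  have step: "q (Suc n) \<in> proj_feasible k p0 \<delta> (T (q n))" for n
    using assms(9)[of "n + 2"] by (simp add: q_def T_def)
  have feas: "q n \<in> feasible k p0 \<delta>" for n
    using assms(9)[of "n + 1"] by (simp add: q_def proj_feasible_iff)

  have steps: "(\<lambda>n. q (Suc n) - q n) \<longlonglongrightarrow> 0"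
  proof (rule steps_tendsto_0)
    show "(L - lam1) / 2 > 0" using \<open>L > lam1\<close> by simp
    show "- (norm (a + transpose D *v c))\<^sup>2 / (2 * m) \<le> ?Q (q n)" for n
      using S_def m by (rule quad_obj_bounded_below)
    show "?Q (q (Suc n)) \<le> ?Q (q n) - (L - lam1) / 2 * (norm (q (Suc n) - q n))\<^sup>2" for n
      using S_def ub \<open>L > 0\<close> feas step[of n, unfolded T_def] by (rule proj_gradient_decrease)
  qed
  have "\<forall>\<^sub>F n in sequentially. \<bar>(q (Suc n) - q n) $ i\<bar> < \<delta> $ i" for i
    using tendstoD[OF tendsto_vec_nth[OF steps, of i], of "\<delta> $ i"] assms(6)[of i] by (simp add: dist_real_def)
  then have "\<forall>\<^sub>F n in sequentially. \<forall>i. \<bar>(q (Suc n) - q n) $ i\<bar> < \<delta> $ i"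
    by (rule eventually_all_finite)
  then obtain N where N: "\<And>n i. n \<ge> N \<Longrightarrow> \<bar>(q (Suc n) - q n) $ i\<bar> < \<delta> $ i"
    by (auto simp: eventually_sequentially)

  have "norm (q (Suc (Suc n)) - q (Suc n)) \<le> sqrt (1 - m / L) * norm (q (Suc n) - q n)"
    if "n \<ge> N" for n
  proof -
    let ?e = "q (Suc n) - q n"
    \<comment> \<open>The face belongs to the later pair of iterates, the two projections whose
      distance is to be bounded; hence \<open>N\<close> is used at \<open>Suc n\<close>.\<close>
    have "q (Suc (Suc n)) \<in> face p0 \<delta> (q (Suc n))"
      using assms(6) feas feas N[of "Suc n"] that by (intro near_feasible_in_face) auto
    then have "norm (q (Suc (Suc n)) - q (Suc n)) \<le> norm (T (q (Suc n)) - T (q n))"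
      by (rule proj_feasible_nonexpansive[OF step step])
    \<comment> \<open>The map \<open>T\<close> is affine, so its constant part cancels.\<close>
    also have "T (q (Suc n)) - T (q n) = ?e - (1 / L) *\<^sub>R (S *v ?e)"
      by (simp add: T matrix_vector_mult_diff_distrib scaleR_diff_right algebra_simps)
    also have "norm \<dots> \<le> sqrt (1 - m / L) * norm ?e"
      using sym m(1) \<open>L > lam1\<close> m(2) ub \<open>L > 0\<close> by (rule gradient_step_contraction)
    finally show ?thesis .
  qed
  moreover have "sqrt (1 - m / L) < 1"
    using m(1) \<open>L > 0\<close> by simp
  ultimately have "convergent q"
    by (intro convergent_geometric_steps)
  then obtain x where x: "q \<longlonglongrightarrow> x" by (auto simp: convergent_def)
  then have "p \<longlonglongrightarrow> x"
    unfolding q_def by (rule LIMSEQ_offset)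
  moreover have "(\<lambda>n. T (q n)) \<longlonglongrightarrow> T x"
    unfolding T
    by (intro tendsto_intros x bounded_linear.tendsto[OF matrix_vector_mul_bounded_linear])
  then have "x \<in> proj_feasible k p0 \<delta> (T x)"
    using step by (intro proj_feasible_closed_graph[OF assms(6) LIMSEQ_Suc[OF x]])
  ultimately show ?thesis unfolding T_def by blast
qed

end
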